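(* Let $P\subset\mathbb{R}^d$ be a simple polytope, $c$ a generic objective function, and $\eta$ a normalization. For any two weights $w,w'\in\mathbb{R}^d$ we have $$\mathcal{A}^\eta_{P,c}(w)\preceq\mathcal{A}^\eta_{P,c}(w')\quad\Longleftrightarrow\quad(\Pi^\eta_{P,c})^w\subseteq(\Pi^\eta_{P,c})^{w'}.$$ Thus, the poset of coherent $c$-multi-arborescences, ordered by $\preceq$, is isomorphic to the poset of nonempty faces of the pivot rule polytope $\Pi^\eta_{P,c}$, ordered by inclusion.
   Context: A $k$-dimensional polytope is simple if every vertex is incident to exactly $k$ edges. $c\in\mathbb{R}^d$ is generic for $P$ if $c^tu\neq c^tv$ for all edges $uv$; $v_{opt}$ is then the unique maximizing vertex, and $\mathrm{Nb}_{P,c}(v)$ is the set of vertices $u$ adjacent to $v$ with $c^tu>c^tv$. A normalization is a function $\eta:\mathbb{R}^d\to\mathbb{R}$ with $\eta(u-v)\neq0$ whenever $u\in\mathrm{Nb}_{P,c}(v)$. A $c$-multi-arborescence is a map $\mathcal{A}:V(P)\to2^{V(P)}\setminus\{\emptyset\}$ with $\mathcal{A}(v_{opt})=\{v_{opt}\}$ and $\mathcal{A}(v)\subseteq\mathrm{Nb}_{P,c}(v)$ for $v\neq v_{opt}$; it is a $c$-arborescence if $|\mathcal{A}(v)|=1$ for all $v$ (then $\mathcal{A}(v)$ is identified with its element). Write $\mathcal{A}\preceq\mathcal{A}'$ if $\mathcal{A}(v)\subseteq\mathcal{A}'(v)$ for all $v\in V(P)$. For an arbitrary weight $w\in\mathbb{R}^d$,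 $\mathcal{A}^\eta_{P,c}(w)$ is the $c$-multi-arborescence such that, for $v\neq v_{opt}$, $\mathcal{A}^\eta_{P,c}(w)(v)$ is the set of all maximizers of $\frac{w^t(u-v)}{\eta(u-v)}$ over $u\in\mathrm{Nb}_{P,c}(v)$. A $c$-multi-arborescence is coherent if it is of this form for some $w$. The pivot rule polytope is $$\Pi^\eta_{P,c}=\operatorname{conv}\left\{\sum_{v\neq v_{opt}}\frac{\mathcal{A}(v)-v}{\eta(\mathcal{A}(v)-v)} : \mathcal{A}\text{ a }c\text{-arborescence}\right\}.$$ For a polytope $Q$ and $w\in\mathbb{R}^d$, $Q^w$ is the face of $Q$ on which $x\mapsto w^tx$ is maximal. *)

theory Defs
  imports "HOL-Analysis.Analysis"
begin

definition vertices :: "(real ^ 'd) set \<Rightarrow> (real ^ 'd) set" where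
  "vertices P = {v. v extreme_point_of P}"

definition adjacent_in :: "(real ^ 'd) set \<Rightarrow> real ^ 'd \<Rightarrow> real ^ 'd \<Rightarrow> bool" where
  "adjacent_in P u v \<longleftrightarrow>
     u \<in> vertices P \<and> v \<in> vertices P \<and> closed_segment u v edge_of P"

definition simple_polytope :: "(real ^ 'd) set \<Rightarrow> bool" where
  "simple_polytope P \<longleftrightarrow>
     polytope P \<and>
     (\<forall>v \<in> vertices P. int (card {e. e edge_of P \<and> v \<in> e}) = aff_dim P)"

definition generic_for :: "(real ^ 'd) set \<Rightarrow> real ^ 'd \<Rightarrow> bool" where
  "generic_for P c \<longleftrightarrow> (\<forall>u v. adjacent_in P u v \<longrightarrow> c \<bullet> u \<noteq> c \<bullet> v)"

definition v_opt :: "(real ^ 'd) set \<Rightarrow> real ^ 'd \<Rightarrow> real ^ 'd" where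
  "v_opt P c = (THE v. v \<in> vertices P \<and> (\<forall>u \<in> vertices P. c \<bullet> u \<le> c \<bullet> v))"

definition Nb :: "(real ^ 'd) set \<Rightarrow> real ^ 'd \<Rightarrow> real ^ 'd \<Rightarrow> (real ^ 'd) set" where
  "Nb P c v = {u. adjacent_in P u v \<and> c \<bullet> u > c \<bullet> v}"

definition normalization ::
    "(real ^ 'd) set \<Rightarrow> real ^ 'd \<Rightarrow> (real ^ 'd \<Rightarrow> real) \<Rightarrow> bool" where
  "normalization P c \<eta> \<longleftrightarrow> (\<forall>v \<in> vertices P. \<forall>u \<in> Nb P c v. \<eta> (u - v) \<noteq> 0)"

text \<open>Maps with domain \<open>V(P)\<close> are represented as extensional functions (undefined outside
  \<open>vertices P\<close>), so that two of them are equal iff they agree on all vertices.\<close>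

definition multi_arborescence ::
    "(real ^ 'd) set \<Rightarrow> real ^ 'd \<Rightarrow> (real ^ 'd \<Rightarrow> (real ^ 'd) set) \<Rightarrow> bool" where
  "multi_arborescence P c A \<longleftrightarrow>
     A \<in> vertices P \<rightarrow>\<^sub>E (Pow (vertices P) - {{}}) \<and>
     (\<forall>v \<in> vertices P. if v = v_opt P c then A v = {v} else A v \<subseteq> Nb P c v)"

definition arborescence ::
    "(real ^ 'd) set \<Rightarrow> real ^ 'd \<Rightarrow> (real ^ 'd \<Rightarrow> (real ^ 'd) set) \<Rightarrow> bool" where
  "arborescence P c A \<longleftrightarrow>
     multi_arborescence P c A \<and> (\<forall>v \<in> vertices P. card (A v) = 1)"

definition arb_le ::
    "(real ^ 'd) set \<Rightarrow> (real ^ 'd \<Rightarrow> (real ^ 'd) set) \<Rightarrow> (real ^ 'd \<Rightarrow> (real ^ 'd) set) \<Rightarrow> bool" where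
  "arb_le P A A' \<longleftrightarrow> (\<forall>v \<in> vertices P. A v \<subseteq> A' v)"

definition weight_arb ::
    "(real ^ 'd) set \<Rightarrow> real ^ 'd \<Rightarrow> (real ^ 'd \<Rightarrow> real) \<Rightarrow> real ^ 'd
      \<Rightarrow> real ^ 'd \<Rightarrow> (real ^ 'd) set" where
  "weight_arb P c \<eta> w = (\<lambda>v \<in> vertices P.
     if v = v_opt P c then {v}
     else {u \<in> Nb P c v. \<forall>u' \<in> Nb P c v.
             (w \<bullet> (u' - v)) / \<eta> (u' - v) \<le> (w \<bullet> (u - v)) / \<eta> (u - v)})"

definition coherent ::
    "(real ^ 'd) set \<Rightarrow> real ^ 'd \<Rightarrow> (real ^ 'd \<Rightarrow> real)
      \<Rightarrow> (real ^ 'd \<Rightarrow> (real ^ 'd) set) \<Rightarrow> bool" where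
  "coherent P c \<eta> A \<longleftrightarrow>
     multi_arborescence P c A \<and> (\<exists>w. A = weight_arb P c \<eta> w)"

definition pivot_rule_polytope ::
    "(real ^ 'd) set \<Rightarrow> real ^ 'd \<Rightarrow> (real ^ 'd \<Rightarrow> real) \<Rightarrow> (real ^ 'd) set" where
  "pivot_rule_polytope P c \<eta> = convex hull
     {\<Sum>v \<in> vertices P - {v_opt P c}.
        (the_elem (A v) - v) /\<^sub>R \<eta> (the_elem (A v) - v) | A. arborescence P c A}"

definition max_face :: "(real ^ 'd) set \<Rightarrow> real ^ 'd \<Rightarrow> (real ^ 'd) set" where
  "max_face Q w = {x \<in> Q. \<forall>y \<in> Q. w \<bullet> y \<le> w \<bullet> x}"

end

theory Submission
  imports Defs
begin

text \<open>
  On the vectors attached to arborescences, a weight \<open>w\<close> acts as a sum of one independent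
  contribution per vertex, so an arborescence is \<open>w\<close>-optimal exactly when it selects at each
  vertex a maximizer, that is, when it lies below \<open>weight_arb P c \<eta> w\<close>. A maximal face of a convex
  hull is spanned by the generators it contains, so inclusion of faces becomes inclusion of the sets
  of arborescences below two multi-arborescences, and hence \<open>arb_le\<close>. Every
  face of a polytope is exposed, so all nonempty faces are obtained this way.
\<close>

section \<open>Edges and improving neighbours\<close>

lemma polytope_eq_hull_vertices:
  assumes "polytope P"
  shows "finite (vertices P)" and "P = convex hull (vertices P)"
proof -
  show "finite (vertices P)"
    using assms unfolding vertices_def by (rule finite_polyhedron_extreme_points[OF polytope_imp_polyhedron])
  show "P = convex hull (vertices P)"
    unfolding vertices_def
    using assms Krein_Milman_Minkowski polytope_imp_compact polytope_imp_convex by blast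
qed

lemma vertices_face:
  assumes "F face_of P"
  shows "vertices F = vertices P \<inter> F"
  using extreme_point_of_face[OF assms] by (auto simp: vertices_def)

lemma adjacent_in_face:
  assumes "F face_of P" "adjacent_in F u v"
  shows "adjacent_in P u v"
  using assms vertices_face[OF assms(1)]
  by (auto simp: adjacent_in_def edge_of_def intro: face_of_trans)

lemma inner_le_vertices:
  assumes "polytope P" "\<And>u. u \<in> vertices P \<Longrightarrow> c \<bullet> u \<le> b" "x \<in> P"
  shows "c \<bullet> x \<le> b"
proof -
  have "convex hull (vertices P) \<subseteq> {x. c \<bullet> x \<le> b}"
    by (rule hull_minimal) (auto simp: assms(2) convex_halfspace_le)
  then show ?thesis
    using polytope_eq_hull_vertices(2)[OF assms(1)] assms(3) by blast
qed

text \<open>Induction on dimension: a one-dimensional polytope is a segment, and in higher dimension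
  \<open>v\<close> lies on a facet, whose edges are edges of \<open>P\<close>. Applied below to
  faces cut out by an objective function.\<close>

lemma vertex_has_adjacent:
  fixes P :: "(real ^ 'd) set"
  assumes "polytope P" "v \<in> vertices P" "P \<noteq> {v}"
  shows "\<exists>u. u \<noteq> v \<and> adjacent_in P u v"
  using assms
proof (induction "nat (aff_dim P)" arbitrary: P rule: less_induct)
  case less
  have vP: "v \<in> P" and ext: "v extreme_point_of P"
    using less.prems by (auto simp: vertices_def extreme_point_of_def)
  have "aff_dim P \<noteq> 0"
    using less.prems(3) vP aff_dim_eq_0 by (metis singletonD)
  moreover have "aff_dim P \<ge> 0"
    using vP aff_dim_negative_iff[of P] by (metis empty_iff not_le)
  ultimately consider "aff_dim P = 1" | "aff_dim P > 1" by linarith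
  then show ?case
  proof cases
    case 1
    then obtain a b where ab: "P = closed_segment a b"
      using compact_convex_collinear_segment[of P] vP less.prems(1)
      by (metis collinear_aff_dim empty_iff order_refl polytope_imp_compact polytope_imp_convex)
    have V: "vertices P = {a, b}"
      by (auto simp: ab vertices_def extreme_point_of_segment)
    have "a \<noteq> b"
      using ab 1 by auto
    have "P edge_of P"
      using 1 by (simp add: edge_of_def face_of_refl less.prems(1) polytope_imp_convex)
    then have "adjacent_in P a b" "adjacent_in P b a"
      using V ab by (auto simp: adjacent_in_def closed_segment_commute)
    then show ?thesis
      using V less.prems(2) \<open>a \<noteq> b\<close> by auto
  next
    case 2
    \<comment> \<open>An extreme point of a set other than \<open>{v}\<close> is not in the relative
      interior, and the relative frontier of a polyhedron is the union of its facets.\<close>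
    have "v \<in> rel_frontier P"
      using extreme_point_not_in_REL_INTERIOR[OF ext less.prems(3)] vP closure_subset
      by (auto simp: rel_frontier_def)
    then obtain F where F: "F facet_of P" "v \<in> F"
      using rel_frontier_of_polyhedron[OF polytope_imp_polyhedron[OF less.prems(1)]] by blast
    then have FP: "F face_of P" and dim: "aff_dim F = aff_dim P - 1"
      by (auto simp: facet_of_def)
    have "F \<noteq> {v}"
      using dim 2 by auto
    moreover have "v \<in> vertices F"
      using vertices_face[OF FP] F(2) less.prems(2) by blast
    ultimately obtain u where "u \<noteq> v" "adjacent_in F u v"
      using less.hyps[of F] dim 2 face_of_polytope_polytope[OF less.prems(1) FP] by auto
    then show ?thesis
      using adjacent_in_face[OF FP] by blast
  qed
qed

text \<open>Parametric simplex step: with \<open>a\<close> exposing \<open>v\<close> and \<open>t\<close> the least parameter at which \<open>v\<close>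
  maximizes \<open>c + t a\<close>, the face of maximizers of \<open>c + t a\<close> is larger than \<open>{v}\<close>, and \<open>v\<close> is
  the only minimizer of \<open>c\<close> on it, so every edge of that face at \<open>v\<close> is improving.\<close>

lemma Nb_nonempty:
  fixes P :: "(real ^ 'd) set"
  assumes P: "polytope P" and v: "v \<in> vertices P" and w: "x \<in> P" "c \<bullet> v < c \<bullet> x"
  shows "Nb P c v \<noteq> {}"
proof -
  have sub: "vertices P \<subseteq> P"
    by (auto simp: vertices_def extreme_point_of_def)
  have "{v} face_of P"
    using v by (simp add: vertices_def face_of_singleton)
  then have "{v} exposed_face_of P"
    using exposed_face_of_polyhedron[OF polytope_imp_polyhedron[OF P]] by blast
  then obtain a b where ab: "P \<subseteq> {x. a \<bullet> x \<le> b}" "{v} = P \<inter> {x. a \<bullet> x = b}"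
    by (auto simp: exposed_face_of_def)
  have less: "a \<bullet> y < a \<bullet> v" if "y \<in> P" "y \<noteq> v" for y
    using ab that by (metis (mono_tags, lifting) IntD2 IntI insertI1 mem_Collect_eq order_le_less
      singletonD subsetD)
  \<comment> \<open>\<open>U\<close> collects the vertices that beat \<open>v\<close> under
    \<open>c\<close>; \<open>r u\<close> solves \<open>c \<bullet> u + t * (a \<bullet> u) = c
    \<bullet> v + t * (a \<bullet> v)\<close> for \<open>t\<close>, the parameter at which
    \<open>u\<close> and \<open>v\<close> tie.\<close>
  define U where "U = {u \<in> vertices P. c \<bullet> u > c \<bullet> v}"
  define r where "r = (\<lambda>u. (c \<bullet> u - c \<bullet> v) / (a \<bullet> v - a \<bullet> u))"
  have "finite U"
    using polytope_eq_hull_vertices(1)[OF P] by (simp add: U_def)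
  have "U \<noteq> {}"
    using inner_le_vertices[OF P _ w(1), of c "c \<bullet> v"] w(2) unfolding U_def by force
  have Ua: "a \<bullet> u < a \<bullet> v" if "u \<in> U" for u
    using that sub less by (auto simp: U_def)
  define t where "t = Max (r ` U)"
  obtain u0 where u0: "u0 \<in> U" "t = r u0"
    using Max_in[of "r ` U"] \<open>finite U\<close> \<open>U \<noteq> {}\<close> unfolding t_def by blast
  have "t > 0"
    using u0 Ua[OF u0(1)] by (simp add: r_def U_def)
  define g where "g = c + t *\<^sub>R a"
  have "g \<bullet> u \<le> g \<bullet> v" if u: "u \<in> vertices P" for u
  proof (cases "u \<in> U")
    case True
    then have "r u \<le> t"
      using \<open>finite U\<close> by (simp add: t_def)
    then show ?thesis
      using Ua[OF True] by (simp add: r_def g_def inner_add_left divide_simps algebra_simps)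
  next
    case False
    have "a \<bullet> u \<le> a \<bullet> v"
      using less u sub by (cases "u = v") (auto intro: less_imp_le)
    then have "t * (a \<bullet> u) \<le> t * (a \<bullet> v)"
      using \<open>t > 0\<close> by simp
    then show ?thesis
      using False u by (simp add: U_def g_def inner_add_left)
  qed
  then have le: "g \<bullet> y \<le> g \<bullet> v" if "y \<in> P" for y
    using inner_le_vertices[OF P] that by blast
  define F where "F = P \<inter> {y. g \<bullet> y = g \<bullet> v}"
  have F: "F face_of P"
    unfolding F_def using le P by (simp add: face_of_Int_supporting_hyperplane_le polytope_imp_convex)
  have "v \<in> vertices F"
    using vertices_face[OF F] v sub by (auto simp: F_def)
  \<comment> \<open>\<open>u0\<close> attains the largest ratio, so it ties with \<open>v\<close>
    under \<open>g\<close> and makes the face larger than \<open>{v}\<close>.\<close>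
  moreover have "u0 \<in> F"
    using u0 Ua[OF u0(1)] sub by (auto simp: U_def F_def g_def r_def inner_add_left field_simps)
  then have "F \<noteq> {v}"
    using Ua[OF u0(1)] by auto
  ultimately obtain u where u: "u \<noteq> v" "adjacent_in F u v"
    using vertex_has_adjacent[OF face_of_polytope_polytope[OF P F]] by blast
  then have "u \<in> F"
    using vertices_face[OF F] by (auto simp: adjacent_in_def)
  \<comment> \<open>On \<open>F\<close> the sum of \<open>c\<close> and \<open>t\<close> times
    \<open>a\<close> is constant, so a strict loss in \<open>a\<close> is a strict gain in
    \<open>c\<close>.\<close>
  then have "g \<bullet> u = g \<bullet> v" "a \<bullet> u < a \<bullet> v"
    using less u(1) by (auto simp: F_def)
  moreover from this have "t * (a \<bullet> u) < t * (a \<bullet> v)"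
    using \<open>t > 0\<close> by simp
  ultimately have "c \<bullet> u > c \<bullet> v"
    by (simp add: g_def inner_add_left)
  then show ?thesis
    using adjacent_in_face[OF F u(2)] by (auto simp: Nb_def)
qed

text \<open>Two maximizers would put a second point on the face where \<open>c\<close> is maximal,
  hence an edge at \<open>v\<close> on which \<open>c\<close> is constant, contradicting
  genericity.\<close>

lemma vertex_max_unique:
  fixes P :: "(real ^ 'd) set"
  assumes P: "polytope P" and gen: "generic_for P c"
    and v: "v \<in> vertices P" "\<And>u. u \<in> vertices P \<Longrightarrow> c \<bullet> u \<le> c \<bullet> v"
    and v': "v' \<in> vertices P" "\<And>u. u \<in> vertices P \<Longrightarrow> c \<bullet> u \<le> c \<bullet> v'"
  shows "v' = v"
proof (rule ccontr)
  assume "v' \<noteq> v"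
  have sub: "vertices P \<subseteq> P"
    by (auto simp: vertices_def extreme_point_of_def)
  define F where "F = P \<inter> {y. c \<bullet> y = c \<bullet> v}"
  have F: "F face_of P"
    unfolding F_def using inner_le_vertices[OF P v(2)] P
    by (simp add: face_of_Int_supporting_hyperplane_le polytope_imp_convex)
  have "v \<in> vertices F" "v' \<in> F"
    using vertices_face[OF F] v v' sub by (auto simp: F_def intro: antisym)
  then obtain u where u: "adjacent_in F u v"
    using vertex_has_adjacent[OF face_of_polytope_polytope[OF P F]] \<open>v' \<noteq> v\<close> by blast
  then have "u \<in> F"
    using vertices_face[OF F] by (auto simp: adjacent_in_def)
  then show False
    using gen adjacent_in_face[OF F u] by (auto simp: F_def generic_for_def)
qed

lemma finite_Nb:
  assumes "polytope P"
  shows "finite (Nb P c v)"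
  by (rule finite_subset[OF _ polytope_eq_hull_vertices(1)[OF assms]])
    (auto simp: Nb_def adjacent_in_def)

text \<open>A vertex that no vertex beats is the unique maximizer, hence the value of the
  \<open>THE\<close> in \<open>v_opt\<close>; any other vertex admits a simplex step.\<close>

lemma Nb_nonempty_of_not_opt:
  fixes P :: "(real ^ 'd) set"
  assumes P: "polytope P" and gen: "generic_for P c"
    and v: "v \<in> vertices P" "v \<noteq> v_opt P c"
  shows "Nb P c v \<noteq> {}"
proof -
  have "\<exists>u\<in>vertices P. c \<bullet> v < c \<bullet> u"
  proof (rule ccontr)
    assume "\<not> ?thesis"
    then have max: "\<And>u. u \<in> vertices P \<Longrightarrow> c \<bullet> u \<le> c \<bullet> v"
      by force
    have "v_opt P c = v"
      unfolding v_opt_def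
      by (rule the_equality) (use v(1) max vertex_max_unique[OF P gen v(1) max] in blast)+
    then show False
      using v(2) by simp
  qed
  then show ?thesis
    using Nb_nonempty[OF P v(1)] by (auto simp: vertices_def extreme_point_of_def)
qed

section \<open>Maximal faces\<close>

text \<open>A linear upper bound on \<open>S\<close> persists on its hull because half-spaces are
  convex, so a generator that is best among generators is best overall.\<close>

lemma max_face_generators: "S \<inter> max_face (convex hull S) w = max_face S w"
proof -
  have "w \<bullet> y \<le> w \<bullet> x" if "\<forall>y\<in>S. w \<bullet> y \<le> w \<bullet> x" "y \<in> convex hull S" for x y
  proof -
    have "convex hull S \<subseteq> {y. w \<bullet> y \<le> w \<bullet> x}"
      by (rule hull_minimal) (use that(1) in \<open>auto simp: convex_halfspace_le\<close>)
    then show ?thesis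
      using that(2) by blast
  qed
  then show ?thesis
    by (auto simp: max_face_def hull_inc)
qed

lemma max_face_eq:
  assumes "x \<in> max_face Q w"
  shows "max_face Q w = Q \<inter> {y. w \<bullet> y = w \<bullet> x}"
  using assms by (force simp: max_face_def intro: antisym)

lemma max_face_face_of:
  assumes "convex Q"
  shows "max_face Q w face_of Q"
proof (cases "max_face Q w = {}")
  case False
  then obtain x where x: "x \<in> max_face Q w"
    by blast
  show ?thesis
    unfolding max_face_eq[OF x]
    by (rule face_of_Int_supporting_hyperplane_le) (use x assms in \<open>auto simp: max_face_def\<close>)
qed simp

text \<open>A face of the hull of a finite set is the hull of some of the generators, and those
  lying in the maximal face are themselves maximal in \<open>S\<close>.\<close>

lemma max_face_convex_hull:
  assumes "finite S"
  shows "max_face (convex hull S) w = convex hull (max_face S w)"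
proof -
  have face: "max_face (convex hull S) w face_of convex hull S"
    by (simp add: max_face_face_of)
  obtain S' where S': "S' \<subseteq> S" "max_face (convex hull S) w = convex hull S'"
    using face_of_convex_hull_subset[OF finite_imp_compact[OF assms] face] .
  have "S' \<subseteq> max_face S w"
    using S' hull_subset[of S' convex] by (subst max_face_generators[symmetric]) auto
  then have "max_face (convex hull S) w \<subseteq> convex hull (max_face S w)"
    unfolding S'(2) by (rule hull_mono)
  moreover have "convex hull (max_face S w) \<subseteq> max_face (convex hull S) w"
    by (rule hull_minimal)
      (use max_face_generators[of S w] face_of_imp_convex[OF face] in auto)
  ultimately show ?thesis
    by blast
qed

text \<open>The face and its generators determine each other: take hulls in one direction, intersect
  with \<open>S\<close> in the other.\<close>

lemma max_face_convex_hull_subset_iff: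
  assumes "finite S"
  shows "max_face (convex hull S) w \<subseteq> max_face (convex hull S) w' \<longleftrightarrow>
    max_face S w \<subseteq> max_face S w'"
  using max_face_convex_hull[OF assms] hull_mono[of "max_face S w" "max_face S w'" convex]
    max_face_generators[of S w] max_face_generators[of S w']
  by blast

lemma max_face_nonempty:
  assumes "compact Q" "Q \<noteq> {}"
  shows "max_face Q w \<noteq> {}"
proof -
  have "continuous_on Q (\<lambda>x. w \<bullet> x)"
    by (intro continuous_intros)
  then obtain x where "x \<in> Q" "\<forall>y\<in>Q. w \<bullet> y \<le> w \<bullet> x"
    using continuous_attains_sup[OF assms] by blast
  then show ?thesis
    by (auto simp: max_face_def)
qed

text \<open>The normal of a hyperplane exposing \<open>F\<close> serves as the weight.\<close>

lemma face_of_polytope_max_face: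
  assumes "polytope Q" "F face_of Q" "F \<noteq> {}"
  shows "\<exists>w. F = max_face Q w"
proof -
  have "F exposed_face_of Q"
    using exposed_face_of_polyhedron[OF polytope_imp_polyhedron[OF assms(1)]] assms(2) by blast
  then obtain a b where ab: "Q \<subseteq> {x. a \<bullet> x \<le> b}" "F = Q \<inter> {x. a \<bullet> x = b}"
    by (auto simp: exposed_face_of_def)
  then obtain x where x: "x \<in> Q" "a \<bullet> x = b"
    using assms(3) by auto
  then have "x \<in> max_face Q a"
    using ab(1) by (auto simp: max_face_def)
  then have "F = max_face Q a"
    using max_face_eq ab(2) x(2) by metis
  then show ?thesis ..
qed

section \<open>Optimal arborescences\<close>

definition arb_vector ::
    "(real ^ 'd) set \<Rightarrow> real ^ 'd \<Rightarrow> (real ^ 'd \<Rightarrow> real)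
      \<Rightarrow> (real ^ 'd \<Rightarrow> (real ^ 'd) set) \<Rightarrow> real ^ 'd" where
  "arb_vector P c \<eta> A = (\<Sum>v \<in> vertices P - {v_opt P c}.
     (the_elem (A v) - v) /\<^sub>R \<eta> (the_elem (A v) - v))"

text \<open>For \<open>\<eta> x = c \<bullet> x\<close> this is the slope of the edge from
  \<open>v\<close> to \<open>u\<close> in the projection to the plane with coordinates
  \<open>c\<close> and \<open>w\<close>, as in the shadow vertex rule.\<close>

definition slope :: "(real ^ 'd \<Rightarrow> real) \<Rightarrow> real ^ 'd \<Rightarrow> real ^ 'd \<Rightarrow> real ^ 'd \<Rightarrow> real" where
  "slope \<eta> w v u = (w \<bullet> (u - v)) / \<eta> (u - v)"

lemma pivot_rule_polytope_eq:
  "pivot_rule_polytope P c \<eta> = convex hull (arb_vector P c \<eta> ` {A. arborescence P c A})"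
  unfolding pivot_rule_polytope_def arb_vector_def by (simp add: setcompr_eq_image)

lemma inner_arb_vector:
  "w \<bullet> arb_vector P c \<eta> A = (\<Sum>v \<in> vertices P - {v_opt P c}. slope \<eta> w v (the_elem (A v)))"
  by (simp add: arb_vector_def slope_def inner_sum_right divide_inverse mult.commute)

section \<open>Multi-arborescences defined by weights\<close>

lemma weight_arb_opt: "v_opt P c \<in> vertices P \<Longrightarrow> weight_arb P c \<eta> w (v_opt P c) = {v_opt P c}"
  by (simp add: weight_arb_def)

lemma weight_arb_not_opt:
  assumes "v \<in> vertices P" "v \<noteq> v_opt P c"
  shows "weight_arb P c \<eta> w v =
    {u \<in> Nb P c v. \<forall>u' \<in> Nb P c v. slope \<eta> w v u' \<le> slope \<eta> w v u}"
  using assms by (simp add: weight_arb_def slope_def)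

text \<open>A finite nonempty set of slopes attains its maximum; genericity supplies the improving
  neighbours.\<close>

lemma weight_arb_nonempty:
  fixes P :: "(real ^ 'd) set"
  assumes "polytope P" "generic_for P c" "v \<in> vertices P"
  shows "weight_arb P c \<eta> w v \<noteq> {}"
proof (cases "v = v_opt P c")
  case True
  then show ?thesis
    using assms(3) weight_arb_opt by blast
next
  case False
  have fin: "finite (slope \<eta> w v ` Nb P c v)" "slope \<eta> w v ` Nb P c v \<noteq> {}"
    using finite_Nb[OF assms(1)] Nb_nonempty_of_not_opt[OF assms False] by auto
  then obtain u where u: "u \<in> Nb P c v" "slope \<eta> w v u = Max (slope \<eta> w v ` Nb P c v)"
    using Max_in by (metis imageE)
  then have "u \<in> weight_arb P c \<eta> w v"
    using fin by (simp add: weight_arb_not_opt[OF assms(3) False])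
  then show ?thesis
    by blast
qed

lemma multi_arborescence_weight_arb:
  fixes P :: "(real ^ 'd) set"
  assumes "polytope P" "generic_for P c"
  shows "multi_arborescence P c (weight_arb P c \<eta> w)"
proof -
  have "weight_arb P c \<eta> w v \<subseteq> vertices P" if "v \<in> vertices P" for v
    using that by (auto simp: weight_arb_def Nb_def adjacent_in_def split: if_splits)
  then have "weight_arb P c \<eta> w \<in> vertices P \<rightarrow>\<^sub>E (Pow (vertices P) - {{}})"
    using weight_arb_nonempty[OF assms] by (auto simp: PiE_iff weight_arb_def)
  then show ?thesis
    unfolding multi_arborescence_def
    by (auto simp: weight_arb_opt weight_arb_not_opt)
qed

section \<open>Arborescences as independent choices at the vertices\<close>

lemma arborescence_singleton:
  assumes "arborescence P c A" "v \<in> vertices P"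
  shows "A v = {the_elem (A v)}"
  using assms by (metis arborescence_def card_1_singletonE the_elem_eq)

lemma arborescence_Nb:
  assumes "arborescence P c A" "v \<in> vertices P" "v \<noteq> v_opt P c"
  shows "the_elem (A v) \<in> Nb P c v"
proof -
  have "A v \<subseteq> Nb P c v"
    using assms by (auto simp: arborescence_def multi_arborescence_def dest: bspec[of _ _ v])
  then show ?thesis
    using arborescence_singleton[OF assms(1,2)] by blast
qed

text \<open>The conditions on an arborescence are imposed vertex by vertex, so choices at different
  vertices do not interact.\<close>

lemma arborescence_selection:
  assumes M: "multi_arborescence P c M" and f: "\<And>v. v \<in> vertices P \<Longrightarrow> f v \<in> M v"
  shows "arborescence P c (\<lambda>v\<in>vertices P. {f v})"
proof -
  have sub: "f v \<in> vertices P" if "v \<in> vertices P" for v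
    using M f[OF that] that by (auto simp: multi_arborescence_def PiE_iff)
  have local: "if v = v_opt P c then M v = {v} else M v \<subseteq> Nb P c v" if "v \<in> vertices P" for v
    using M that unfolding multi_arborescence_def by blast
  have "f v = v" if "v \<in> vertices P" "v = v_opt P c" for v
    using local[OF that(1)] f[OF that(1)] that(2) by auto
  moreover have "f v \<in> Nb P c v" if "v \<in> vertices P" "v \<noteq> v_opt P c" for v
    using local[OF that(1)] f[OF that(1)] that(2) by auto
  ultimately show ?thesis
    using sub by (auto simp: arborescence_def multi_arborescence_def)
qed

lemma arborescence_update:
  assumes A: "arborescence P c A" and v: "v \<in> vertices P" "v \<noteq> v_opt P c" and u: "u \<in> Nb P c v"
  shows "arborescence P c (A(v := {u}))"
proof -
  have "u \<in> vertices P"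
    using u by (simp add: Nb_def adjacent_in_def)
  then show ?thesis
    using A v u by (simp add: arborescence_def multi_arborescence_def PiE_iff extensional_def)
qed

lemma finite_arborescences:
  assumes "polytope P"
  shows "finite {A. arborescence P c A}"
proof (rule finite_subset)
  show "{A. arborescence P c A} \<subseteq> vertices P \<rightarrow>\<^sub>E (Pow (vertices P) - {{}})"
    by (auto simp: arborescence_def multi_arborescence_def)
  show "finite (vertices P \<rightarrow>\<^sub>E (Pow (vertices P) - {{}}))"
    using polytope_eq_hull_vertices(1)[OF assms] by (simp add: finite_PiE)
qed

section \<open>Comparing optimal arborescences with the order\<close>

lemma arb_le_weight_arb_iff:
  assumes "arborescence P c A"
  shows "arb_le P A (weight_arb P c \<eta> w) \<longleftrightarrow>
    (\<forall>v \<in> vertices P - {v_opt P c}. \<forall>u \<in> Nb P c v. slope \<eta> w v u \<le> slope \<eta> w v (the_elem (A v)))"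
proof -
  have "A v \<subseteq> weight_arb P c \<eta> w v \<longleftrightarrow> v = v_opt P c \<or>
      (\<forall>u \<in> Nb P c v. slope \<eta> w v u \<le> slope \<eta> w v (the_elem (A v)))"
    if v: "v \<in> vertices P" for v
  proof (cases "v = v_opt P c")
    case True
    then show ?thesis
      using assms v by (auto simp: weight_arb_def arborescence_def multi_arborescence_def)
  next
    case False
    have "A v \<subseteq> weight_arb P c \<eta> w v \<longleftrightarrow> the_elem (A v) \<in> weight_arb P c \<eta> w v"
      using arborescence_singleton[OF assms v] by (metis insert_subset empty_subsetI)
    then show ?thesis
      using False arborescence_Nb[OF assms v False] by (simp add: weight_arb_not_opt[OF v False])
  qed
  then show ?thesis
    unfolding arb_le_def by blast
qed

text \<open>The \<open>w\<close>-value is a sum with one independent term per vertex, so it is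
  maximal iff every term is. Distinct arborescences may share a vector; this is harmless, since
  maximality depends only on the vector.\<close>

lemma arb_vector_max_face_iff:
  fixes P :: "(real ^ 'd) set"
  assumes P: "polytope P" and A: "arborescence P c A"
  shows "arb_vector P c \<eta> A \<in> max_face (arb_vector P c \<eta> ` {A. arborescence P c A}) w \<longleftrightarrow>
    arb_le P A (weight_arb P c \<eta> w)"
proof -
  let ?W = "vertices P - {v_opt P c}"
  have fin: "finite ?W"
    using polytope_eq_hull_vertices(1)[OF P] by simp
  have "(\<forall>B. arborescence P c B \<longrightarrow> w \<bullet> arb_vector P c \<eta> B \<le> w \<bullet> arb_vector P c \<eta> A) \<longleftrightarrow>
      (\<forall>v \<in> ?W. \<forall>u \<in> Nb P c v. slope \<eta> w v u \<le> slope \<eta> w v (the_elem (A v)))" (is "?L \<longleftrightarrow> ?R")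
  proof
    assume max: ?L
    show ?R
    proof (intro ballI)
      fix v u
      assume v: "v \<in> ?W" and u: "u \<in> Nb P c v"
      \<comment> \<open>Changing \<open>A\<close> at \<open>v\<close> alone leaves all other
        summands equal, so they cancel in the comparison of the two values.\<close>
      have "arborescence P c (A(v := {u}))"
        using arborescence_update[OF A] v u by blast
      then have "w \<bullet> arb_vector P c \<eta> (A(v := {u})) \<le> w \<bullet> arb_vector P c \<eta> A"
        using max by blast
      moreover have "(\<Sum>x \<in> ?W - {v}. slope \<eta> w x (the_elem ((A(v := {u})) x))) =
          (\<Sum>x \<in> ?W - {v}. slope \<eta> w x (the_elem (A x)))"
        by (rule sum.cong) auto
      ultimately show "slope \<eta> w v u \<le> slope \<eta> w v (the_elem (A v))"
        unfolding inner_arb_vector sum.remove[OF fin v] by simp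
    qed
  next
    assume ?R
    then show ?L
      unfolding inner_arb_vector using arborescence_Nb by (blast intro: sum_mono)
  qed
  then show ?thesis
    using A unfolding arb_le_weight_arb_iff[OF A] by (auto simp: max_face_def)
qed

text \<open>A multi-arborescence is the pointwise union of the arborescences below it, so these
  determine the order.\<close>

lemma arb_le_iff_arborescences:
  assumes M: "multi_arborescence P c M"
  shows "arb_le P M M' \<longleftrightarrow> (\<forall>A. arborescence P c A \<longrightarrow> arb_le P A M \<longrightarrow> arb_le P A M')"
proof
  assume "arb_le P M M'"
  then show "\<forall>A. arborescence P c A \<longrightarrow> arb_le P A M \<longrightarrow> arb_le P A M'"
    unfolding arb_le_def by blast
next
  assume R: "\<forall>A. arborescence P c A \<longrightarrow> arb_le P A M \<longrightarrow> arb_le P A M'"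
  show "arb_le P M M'"
    unfolding arb_le_def
  proof (intro ballI subsetI)
    fix v u
    assume v: "v \<in> vertices P" and u: "u \<in> M v"
    have "\<exists>x. x \<in> M y" if "y \<in> vertices P" for y
      using M that by (auto simp: multi_arborescence_def PiE_iff)
    then obtain g where g: "\<And>y. y \<in> vertices P \<Longrightarrow> g y \<in> M y"
      by metis
    \<comment> \<open>The selection is forced to take the given \<open>u\<close> at
      \<open>v\<close>; elsewhere any choice from \<open>M\<close> will do.\<close>
    define A where "A = (\<lambda>y\<in>vertices P. {(g(v := u)) y})"
    have "arborescence P c A"
      unfolding A_def by (rule arborescence_selection[OF M]) (use g u in auto)
    moreover have "arb_le P A M"
      using g u by (auto simp: arb_le_def A_def)
    ultimately have "arb_le P A M'"
      using R by blast
    then show "u \<in> M' v"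
      using v by (auto simp: arb_le_def A_def)
  qed
qed

lemma arb_le_iff_max_face_subset:
  fixes P :: "(real ^ 'd) set"
  assumes P: "polytope P" and gen: "generic_for P c"
  shows "arb_le P (weight_arb P c \<eta> w) (weight_arb P c \<eta> w') \<longleftrightarrow>
    max_face (pivot_rule_polytope P c \<eta>) w \<subseteq> max_face (pivot_rule_polytope P c \<eta>) w'"
proof -
  let ?S = "arb_vector P c \<eta> ` {A. arborescence P c A}"
  have "max_face ?S w \<subseteq> ?S"
    by (auto simp: max_face_def)
  then have "max_face ?S w \<subseteq> max_face ?S w' \<longleftrightarrow>
      (\<forall>A. arborescence P c A \<longrightarrow> arb_vector P c \<eta> A \<in> max_face ?S w \<longrightarrow>
        arb_vector P c \<eta> A \<in> max_face ?S w')"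
    by blast
  then show ?thesis
    unfolding pivot_rule_polytope_eq
      max_face_convex_hull_subset_iff[OF finite_imageI[OF finite_arborescences[OF P]]]
      arb_le_iff_arborescences[OF multi_arborescence_weight_arb[OF P gen]]
    using arb_vector_max_face_iff[OF P] by blast
qed

section \<open>The poset of faces of the pivot rule polytope\<close>

lemma polytope_pivot_rule_polytope:
  fixes P :: "(real ^ 'd) set"
  assumes "polytope P"
  shows "polytope (pivot_rule_polytope P c \<eta>)"
  unfolding polytope_def pivot_rule_polytope_eq using finite_arborescences[OF assms] by blast

lemma pivot_rule_polytope_nonempty:
  fixes P :: "(real ^ 'd) set"
  assumes "polytope P" "generic_for P c"
  shows "pivot_rule_polytope P c \<eta> \<noteq> {}"
proof -
  \<comment> \<open>Any weight would do; under weight 0 all slopes vanish and every improving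
    neighbour is a maximizer.\<close>
  have "arborescence P c (\<lambda>v\<in>vertices P. {SOME u. u \<in> weight_arb P c \<eta> 0 v})"
    by (rule arborescence_selection[OF multi_arborescence_weight_arb[OF assms]])
      (use weight_arb_nonempty[OF assms] some_in_eq in blast)
  then show ?thesis
    by (auto simp: pivot_rule_polytope_eq)
qed

lemma arb_le_antisym:
  assumes "multi_arborescence P c A" "multi_arborescence P c A'" "arb_le P A A'" "arb_le P A' A"
  shows "A = A'"
proof (rule extensionalityI)
  show "A \<in> extensional (vertices P)" "A' \<in> extensional (vertices P)"
    using assms(1,2) by (auto simp: multi_arborescence_def PiE_iff)
  show "A v = A' v" if "v \<in> vertices P" for v
    using assms(3,4) that by (auto simp: arb_le_def)
qed

theorem theorem5p4:
  fixes P :: "(real ^ 'd) set" and c :: "real ^ 'd" and \<eta> :: "real ^ 'd \<Rightarrow> real"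
  assumes "simple_polytope P"
    and "generic_for P c"
    and "normalization P c \<eta>"
  shows "(\<forall>w w'. arb_le P (weight_arb P c \<eta> w) (weight_arb P c \<eta> w') \<longleftrightarrow>
             max_face (pivot_rule_polytope P c \<eta>) w \<subseteq> max_face (pivot_rule_polytope P c \<eta>) w')
       \<and> (\<exists>\<Phi>. bij_betw \<Phi> {A. coherent P c \<eta> A}
                   {F. F face_of pivot_rule_polytope P c \<eta> \<and> F \<noteq> {}} \<and>
            (\<forall>A A'. coherent P c \<eta> A \<longrightarrow> coherent P c \<eta> A' \<longrightarrow>
               (arb_le P A A' \<longleftrightarrow> \<Phi> A \<subseteq> \<Phi> A')))"
proof -
  have P: "polytope P"
    using assms(1) by (simp add: simple_polytope_def)
  note gen = assms(2)
  note le_iff = arb_le_iff_max_face_subset[OF P gen]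
  let ?Q = "pivot_rule_polytope P c \<eta>"
  have Q: "polytope ?Q" "?Q \<noteq> {}"
    using polytope_pivot_rule_polytope[OF P] pivot_rule_polytope_nonempty[OF P gen] by auto
  \<comment> \<open>A coherent map can come from many weights. By \<open>le_iff\<close> in both
    directions they all give the same face, so the chosen weight does not matter.\<close>
  define \<Phi> where "\<Phi> = (\<lambda>A. max_face ?Q (SOME w. A = weight_arb P c \<eta> w))"
  have coh: "coherent P c \<eta> A \<longleftrightarrow> (\<exists>w. A = weight_arb P c \<eta> w)" for A
    using multi_arborescence_weight_arb[OF P gen] by (auto simp: coherent_def)
  have \<Phi>: "\<Phi> (weight_arb P c \<eta> w) = max_face ?Q w" for w
  proof -
    have "weight_arb P c \<eta> w = weight_arb P c \<eta> (SOME w'. weight_arb P c \<eta> w = weight_arb P c \<eta> w')"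
      by (rule someI) (rule refl)
    then show ?thesis
      unfolding \<Phi>_def using le_iff by (metis (lifting) antisym order_refl)
  qed
  have order: "arb_le P A A' \<longleftrightarrow> \<Phi> A \<subseteq> \<Phi> A'" if "coherent P c \<eta> A" "coherent P c \<eta> A'" for A A'
    using that le_iff by (auto simp: coh \<Phi>)
  have "bij_betw \<Phi> {A. coherent P c \<eta> A} {F. F face_of ?Q \<and> F \<noteq> {}}"
    unfolding bij_betw_def
  proof
    \<comment> \<open>Equal images give \<open>arb_le\<close> both ways, and \<open>arb_le\<close>
      is antisymmetric on extensional maps.\<close>
    show "inj_on \<Phi> {A. coherent P c \<eta> A}"
    proof (rule inj_onI)
      fix A A'
      assume "A \<in> {A. coherent P c \<eta> A}" "A' \<in> {A. coherent P c \<eta> A}" "\<Phi> A = \<Phi> A'"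
      then show "A = A'"
        using order[of A A'] order[of A' A] arb_le_antisym[of P c A A']
        by (auto simp: coherent_def)
    qed
    have "{A. coherent P c \<eta> A} = range (weight_arb P c \<eta>)"
      by (auto simp: coh)
    then have "\<Phi> ` {A. coherent P c \<eta> A} = range (max_face ?Q)"
      by (simp add: image_image \<Phi>)
    \<comment> \<open>Compactness makes every maximal face nonempty; conversely every nonempty face
      is exposed by some weight.\<close>
    also have "\<dots> = {F. F face_of ?Q \<and> F \<noteq> {}}"
      using max_face_face_of[OF polytope_imp_convex[OF Q(1)]]
        max_face_nonempty[OF polytope_imp_compact[OF Q(1)] Q(2)] face_of_polytope_max_face[OF Q(1)]
      by blast
    finally show "\<Phi> ` {A. coherent P c \<eta> A} = {F. F face_of ?Q \<and> F \<noteq> {}}" .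
  qed
  then show ?thesis
    using le_iff order by blast
qed

end
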